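(* For the class of general contribution games with reward functions in (the multi-dimensional extension of) class $\mathcal{C}$ for all $e\in E$ that have a setwise equilibrium, the price of anarchy for setwise equilibria is at most $k$, where $k=\max_{e\in E}|e|$ is the size of the largest project.
   Context: General contribution game: a finite hypergraph $G=(V,E)$, where each node $v\in V$ is a player with budget $B_v\ge0$ and each hyperedge $e\in E$, $e\subseteq V$, is a joint project of a set of players. A strategy of player $v$ assigns an effort $s_v(e)\ge 0$ to each hyperedge $e\ni v$ with $\sum_{e\ni v}s_v(e)\le B_v$; a state $s=(s_v)_{v\in V}$ consists of one strategy per player. Each hyperedge has a reward function $f_e:(\mathbb{R}_{\ge0})^{|e|}\to\mathbb{R}_{\ge0}$ evaluated at $s_e=(s_u(e))_{u\in e}$. The utility of $v$ is $w_v(s)=\sum_{e\ni v}f_e(s_e)$ and the social welfare is $w(s)=\sum_{v\in V}w_v(s)$. A social optimum $s^*$ is a state maximizing $w$. Class $\mathcal{C}$ in multiple dimensions: symmetric functions, nondecreasing in each argument, nonnegative, that are coordinate-convex ($\partial^2 f/\partial x_i^2\ge0$ for each argument $x_i$) and have non-negative mixed partial second derivatives $\partial^2 f/\partial x_i\partial x_j\ge0$ for any pair of dimensions. A setwise equilibrium is a state $s$ such that for every $e\in E$, every nonempty $U\subseteq e$, and every joint deviation $s'_U=(s'_u)_{u\in U}$ there is at least one player $v\in U$ with $w_v(s)\ge w_v(s'_U,s_{-U})$. The price of anarchy for setwise equilibria of a game is the ratio $w(s^* )/w(s)$ for the worst setwise equilibrium $s$ (the one of smallest welfare); the bound is asserted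 for every game of the class that has a setwise equilibrium. *)

theory Defs
  imports "HOL-Analysis.Analysis"
begin

text \<open>
  The orthant \<open>(\<real>\<^sub>\<ge>\<^sub>0)\<^bsup>|e|\<^esup>\<close> is represented, with coordinates indexed by the players in \<open>e\<close>,
  by the extensional functions \<open>e \<rightarrow>\<^sub>E {0..}\<close>; its interior is \<open>e \<rightarrow>\<^sub>E {0<..}\<close>.
\<close>

definition partial_deriv :: "'v \<Rightarrow> (('v \<Rightarrow> real) \<Rightarrow> real) \<Rightarrow> ('v \<Rightarrow> real) \<Rightarrow> real"
  where "partial_deriv i g x = deriv (\<lambda>t. g (x(i := t))) (x i)"

definition partially_differentiable :: "'v \<Rightarrow> (('v \<Rightarrow> real) \<Rightarrow> real) \<Rightarrow> ('v \<Rightarrow> real) \<Rightarrow> bool"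
  where "partially_differentiable i g x \<longleftrightarrow> (\<lambda>t. g (x(i := t))) field_differentiable at (x i)"

text \<open>
  Second partial derivatives are only required to exist at interior points of the orthant, and the
  function has to be continuous up to the boundary.  This admits functions such as
  \<open>(x\<^sub>1 + x\<^sub>2) powr (3/2)\<close>, whose second derivatives blow up at the origin.  No continuity of the
  derivatives is required, so both orders of a mixed derivative are constrained.
\<close>

definition twice_partially_differentiable :: "'v set \<Rightarrow> (('v \<Rightarrow> real) \<Rightarrow> real) \<Rightarrow> bool"
  where "twice_partially_differentiable e g \<longleftrightarrow>
    continuous_on (e \<rightarrow>\<^sub>E {0..}) g \<and>
    (\<forall>x \<in> e \<rightarrow>\<^sub>E {0<..}. \<forall>i\<in>e. partially_differentiable i g x \<and>
       (\<forall>j\<in>e. partially_differentiable j (partial_deriv i g) x))"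

definition symmetric_reward :: "'v set \<Rightarrow> (('v \<Rightarrow> real) \<Rightarrow> real) \<Rightarrow> bool"
  where "symmetric_reward e g \<longleftrightarrow>
    (\<forall>\<pi>. \<pi> permutes e \<longrightarrow> (\<forall>x \<in> e \<rightarrow>\<^sub>E {0..}. g (x \<circ> \<pi>) = g x))"

definition nondecreasing_each :: "'v set \<Rightarrow> (('v \<Rightarrow> real) \<Rightarrow> real) \<Rightarrow> bool"
  where "nondecreasing_each e g \<longleftrightarrow>
    (\<forall>x \<in> e \<rightarrow>\<^sub>E {0..}. \<forall>i\<in>e. mono_on {0..} (\<lambda>t. g (x(i := t))))"

definition coordinate_convex :: "'v set \<Rightarrow> (('v \<Rightarrow> real) \<Rightarrow> real) \<Rightarrow> bool"
  where "coordinate_convex e g \<longleftrightarrow>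
    (\<forall>x \<in> e \<rightarrow>\<^sub>E {0<..}. \<forall>i\<in>e. partial_deriv i (partial_deriv i g) x \<ge> 0)"

definition nonneg_mixed_partials :: "'v set \<Rightarrow> (('v \<Rightarrow> real) \<Rightarrow> real) \<Rightarrow> bool"
  where "nonneg_mixed_partials e g \<longleftrightarrow>
    (\<forall>x \<in> e \<rightarrow>\<^sub>E {0<..}. \<forall>i\<in>e. \<forall>j\<in>e. i \<noteq> j \<longrightarrow> partial_deriv i (partial_deriv j g) x \<ge> 0)"

definition class_C :: "'v set \<Rightarrow> (('v \<Rightarrow> real) \<Rightarrow> real) \<Rightarrow> bool"
  where "class_C e g \<longleftrightarrow>
    symmetric_reward e g \<and>
    nondecreasing_each e g \<and>
    (\<forall>x \<in> e \<rightarrow>\<^sub>E {0..}. g x \<ge> 0) \<and>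
    twice_partially_differentiable e g \<and>
    coordinate_convex e g \<and>
    nonneg_mixed_partials e g"

locale contribution_game =
  fixes V :: "'v set"
    and E :: "'v set set"
    and B :: "'v \<Rightarrow> real"
    and f :: "'v set \<Rightarrow> ('v \<Rightarrow> real) \<Rightarrow> real"
  assumes finite_players: "finite V"
    and hyperedges: "E \<subseteq> Pow V"
    and budget_nonneg: "v \<in> V \<Longrightarrow> B v \<ge> 0"
    and reward_nonneg: "e \<in> E \<Longrightarrow> x \<in> e \<rightarrow>\<^sub>E {0..} \<Longrightarrow> f e x \<ge> 0"
begin

definition strategies :: "'v \<Rightarrow> ('v set \<Rightarrow> real) set"
  where "strategies v = {\<sigma> \<in> {e \<in> E. v \<in> e} \<rightarrow>\<^sub>E {0..}. (\<Sum>e | e \<in> E \<and> v \<in> e. \<sigma> e) \<le> B v}"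

definition states :: "('v \<Rightarrow> 'v set \<Rightarrow> real) set"
  where "states = (\<Pi>\<^sub>E v\<in>V. strategies v)"

definition efforts :: "('v \<Rightarrow> 'v set \<Rightarrow> real) \<Rightarrow> 'v set \<Rightarrow> 'v \<Rightarrow> real"
  where "efforts s e = (\<lambda>u\<in>e. s u e)"

definition utility :: "'v \<Rightarrow> ('v \<Rightarrow> 'v set \<Rightarrow> real) \<Rightarrow> real"
  where "utility v s = (\<Sum>e | e \<in> E \<and> v \<in> e. f e (efforts s e))"

definition welfare :: "('v \<Rightarrow> 'v set \<Rightarrow> real) \<Rightarrow> real"
  where "welfare s = (\<Sum>v\<in>V. utility v s)"

definition social_optimum :: "('v \<Rightarrow> 'v set \<Rightarrow> real) \<Rightarrow> bool"
  where "social_optimum s \<longleftrightarrow> s \<in> states \<and> (\<forall>s'\<in>states. welfare s' \<le> welfare s)"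

definition setwise_equilibrium :: "('v \<Rightarrow> 'v set \<Rightarrow> real) \<Rightarrow> bool"
  where "setwise_equilibrium s \<longleftrightarrow> s \<in> states \<and>
    (\<forall>e\<in>E. \<forall>U. U \<subseteq> e \<and> U \<noteq> {} \<longrightarrow>
      (\<forall>s' \<in> (\<Pi>\<^sub>E u\<in>U. strategies u). \<exists>v\<in>U. utility v s \<ge> utility v (override_on s s' U)))"

text \<open>
  The supremum over all equilibria is the ratio for the worst one whenever a worst one exists.
  Division in \<^typ>\<open>ennreal\<close> gives \<open>a / 0 = \<top>\<close> for \<open>a > 0\<close> and \<open>0 / 0 = 0\<close>, so an equilibrium of
  welfare 0 makes the price of anarchy infinite unless every state has welfare 0.
\<close>

definition price_of_anarchy :: ennreal
  where "price_of_anarchy =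
    (SUP s \<in> {s. setwise_equilibrium s}. SUP s_opt \<in> {s. social_optimum s}.
       ennreal (welfare s_opt) / ennreal (welfare s))"

lemma compact_strategies: "compact (strategies v)"
proof -
  let ?I = "{e \<in> E. v \<in> e}"
  let ?R = "\<lambda>e. if e \<in> ?I then {0..B v} else {undefined}"
  have fin: "finite ?I"
    using finite_players hyperedges by (simp add: finite_subset)
  have "compactin (product_topology (\<lambda>_. euclidean) UNIV) (PiE UNIV ?R)"
    by (subst compactin_PiE) auto
  then have "compact (PiE UNIV ?R)"
    by (simp add: euclidean_product_topology)
  moreover have "closed {\<sigma> :: 'v set \<Rightarrow> real. sum \<sigma> ?I \<le> B v}"
    by (intro closed_Collect_le continuous_intros continuous_on_product_coordinates)
  moreover have "strategies v = PiE UNIV ?R \<inter> {\<sigma>. sum \<sigma> ?I \<le> B v}"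
  proof (intro set_eqI iffI)
    fix \<sigma> assume a: "\<sigma> \<in> strategies v"
    then have nn: "\<And>e. e \<in> ?I \<Longrightarrow> 0 \<le> \<sigma> e" and le: "sum \<sigma> ?I \<le> B v"
      by (auto simp: strategies_def PiE_iff)
    have "\<sigma> e \<le> B v" if "e \<in> ?I" for e
      using member_le_sum[of e ?I \<sigma>] that nn fin le by force
    with a show "\<sigma> \<in> PiE UNIV ?R \<inter> {\<sigma>. sum \<sigma> ?I \<le> B v}"
      by (auto simp: strategies_def PiE_iff extensional_def)
  next
    fix \<sigma> assume a: "\<sigma> \<in> PiE UNIV ?R \<inter> {\<sigma>. sum \<sigma> ?I \<le> B v}"
    then have mem: "\<sigma> e \<in> ?R e" for e
      by (simp only: Int_iff PiE_iff) blast
    have "\<sigma> e \<ge> 0" if "e \<in> ?I" for e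
      using mem[of e] that by simp
    moreover have "\<sigma> e = undefined" if "e \<notin> ?I" for e
      using mem[of e] that by (simp only: if_False singleton_iff)
    ultimately show "\<sigma> \<in> strategies v"
      using a by (simp add: strategies_def PiE_iff extensional_def)
  qed
  ultimately show ?thesis
    by (simp add: compact_Int_closed)
qed

lemma compact_states: "compact states"
proof -
  let ?R = "\<lambda>v. if v \<in> V then strategies v else {undefined}"
  have "compactin (product_topology (\<lambda>_. euclidean) UNIV) (PiE UNIV ?R)"
    by (subst compactin_PiE) (auto simp: compact_strategies)
  moreover have "states = PiE UNIV ?R"
    by (auto simp: states_def PiE_iff extensional_def split: if_splits)
  ultimately show ?thesis
    by (simp add: euclidean_product_topology)
qed

lemma states_nonempty: "states \<noteq> {}"
proof -
  have "(\<lambda>e \<in> {e \<in> E. v \<in> e}. 0) \<in> strategies v" if "v \<in> V" for v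
    using that budget_nonneg by (auto simp: strategies_def)
  then show ?thesis
    by (auto simp: states_def PiE_eq_empty_iff)
qed

lemma efforts_orthant:
  assumes "s \<in> states" "e \<in> E" shows "efforts s e \<in> e \<rightarrow>\<^sub>E {0..}"
  using assms hyperedges
  by (fastforce simp: efforts_def states_def strategies_def PiE_iff)

text \<open>In particular, the inner supremum in \<open>price_of_anarchy\<close> is never over the empty set.\<close>

lemma social_optimum_exists:
  assumes "\<forall>e\<in>E. class_C e (f e)"
  shows "\<exists>s. social_optimum s"
proof -
  have cont: "continuous_on states (\<lambda>s. f e (efforts s e))" if "e \<in> E" for e
  proof (rule continuous_on_compose2[where g = "f e" and t = "e \<rightarrow>\<^sub>E {0..}"])
    show "continuous_on (e \<rightarrow>\<^sub>E {0..}) (f e)"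
      using assms that by (auto simp: class_C_def twice_partially_differentiable_def)
    show "continuous_on states (\<lambda>s. efforts s e)"
    proof (rule continuous_on_coordinatewise_then_product)
      fix u
      have "continuous_on states (\<lambda>s. s u e)"
        by (rule continuous_on_product_then_coordinatewise)
          (rule continuous_on_product_then_coordinatewise, rule continuous_on_id)
      then show "continuous_on states (\<lambda>s. efforts s e u)"
        by (cases "u \<in> e") (simp_all add: efforts_def)
    qed
    show "(\<lambda>s. efforts s e) ` states \<subseteq> e \<rightarrow>\<^sub>E {0..}"
      using efforts_orthant that by blast
  qed
  have "continuous_on states welfare"
    unfolding welfare_def utility_def by (intro continuous_on_sum cont) auto
  from continuous_attains_sup[OF compact_states states_nonempty this] show ?thesis
    by (auto simp: social_optimum_def)
qed

end

end

theory Submission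
  imports Defs
begin

text \<open>
  The welfare is a convex nondecreasing function of each single player's strategy that separates
  over the projects, so it does not decrease when the players, one after another, move their whole
  budget to a suitable single project.  In such a state the sets \<open>U e\<close> of players concentrated on
  \<open>e\<close> are disjoint.  In a setwise equilibrium the joint deviation of \<open>U e\<close> to \<open>e\<close> fails to improve
  some player of \<open>U e\<close>, whose utility is therefore at least the reward of \<open>e\<close> in the concentrated
  state; summing over \<open>e\<close> charges every reward, which is collected by at most \<open>k\<close> players, to a
  different player.  Since \<open>f e 0\<close> may be positive, the accounting is done for \<open>f e - f e 0\<close>.
\<close>

section \<open>Convexity of rewards along coordinates, up to the boundary of the orthant\<close>

lemma convex_on_coordinate_interior:
  assumes "class_C e g" "i \<in> e" and x: "x \<in> e \<rightarrow>\<^sub>E {0<..}"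
  shows "convex_on {0<..} (\<lambda>t. g (x(i := t)))"
proof -
  define \<phi> where "\<phi> = (\<lambda>t. g (x(i := t)))"
  have mem: "x(i := t) \<in> e \<rightarrow>\<^sub>E {0<..}" if "t > 0" for t
    using x that \<open>i \<in> e\<close> by (auto simp: PiE_iff extensional_def)
  have pd: "partial_deriv i g (x(i := t)) = deriv \<phi> t" for t
    by (simp add: partial_deriv_def \<phi>_def)
  have 1: "(\<phi> has_real_derivative deriv \<phi> t) (at t)" if "t > 0" for t
  proof -
    have "partially_differentiable i g (x(i := t))"
      using assms mem[OF that] by (auto simp: class_C_def twice_partially_differentiable_def)
    then show ?thesis
      by (simp add: partially_differentiable_def \<phi>_def field_differentiable_derivI)
  qed
  have 2: "(deriv \<phi> has_real_derivative deriv (deriv \<phi>) t) (at t)" if "t > 0" for t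
  proof -
    have "partially_differentiable i (partial_deriv i g) (x(i := t))"
      using assms mem[OF that] by (auto simp: class_C_def twice_partially_differentiable_def)
    then show ?thesis
      by (simp add: partially_differentiable_def pd field_differentiable_derivI)
  qed
  have 3: "deriv (deriv \<phi>) t \<ge> 0" if "t > 0" for t
  proof -
    have "partial_deriv i (partial_deriv i g) (x(i := t)) \<ge> 0"
      using assms mem[OF that] by (auto simp: class_C_def coordinate_convex_def)
    then show ?thesis
      by (simp add: partial_deriv_def[of i "partial_deriv i g"] pd)
  qed
  have "convex_on {0<..} \<phi>"
    by (rule f''_ge0_imp_convex[where f' = "deriv \<phi>" and f'' = "deriv (deriv \<phi>)"])
      (auto intro: 1 2 3)
  then show ?thesis by (simp add: \<phi>_def)
qed

text \<open>The derivative conditions of \<open>class_C\<close> speak of interior points only,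
  whereas idle players contribute 0. Shifting all coordinates by a small positive amount reduces to
  the interior, and continuity on the closed orthant carries the inequality to the limit.\<close>

lemma convex_on_coordinate:
  assumes C: "class_C e g" and i: "i \<in> e" and x: "x \<in> e \<rightarrow>\<^sub>E {0..}"
  shows "convex_on {0..} (\<lambda>t. g (x(i := t)))"
proof (rule convex_onI)
  fix u a b :: real
  assume u: "0 < u" "u < 1" and ab: "a \<in> {0..}" "b \<in> {0..}"
  define shift where "shift = (\<lambda>(y :: 'a \<Rightarrow> real) \<epsilon>. \<lambda>v\<in>e. y v + \<epsilon>)"
  let ?c = "(1 - u) * a + u * b"
  have mem: "x(i := t) \<in> e \<rightarrow>\<^sub>E {0..}" if "t \<ge> 0" for t
    using x that i by (auto simp: PiE_iff extensional_def)
  \<comment> \<open>Coordinate \<open>i\<close> is shifted as well: the three points move to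
    \<open>a + \<epsilon>\<close>, \<open>b + \<epsilon>\<close> and \<open>?c + \<epsilon>\<close>
    on one interior slice, and translation preserves convex combinations.\<close>
  have shift_upd: "shift (x(i := t)) \<epsilon> = (shift x \<epsilon>)(i := t + \<epsilon>)" for t \<epsilon>
    using i by (auto simp: shift_def)
  have lim: "((\<lambda>\<epsilon>. g (shift (x(i := t)) \<epsilon>)) \<longlongrightarrow> g (x(i := t))) (at_right 0)" if "t \<ge> 0" for t
  proof -
    let ?y = "x(i := t)"
    have y0: "shift ?y 0 = ?y"
      using mem[OF that] by (auto simp: shift_def PiE_iff extensional_def fun_eq_iff)
    have "continuous_on {0..} (\<lambda>\<epsilon>. g (shift ?y \<epsilon>))"
    proof (rule continuous_on_compose2[where g = g and t = "e \<rightarrow>\<^sub>E {0..}"])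
      show "continuous_on (e \<rightarrow>\<^sub>E {0..}) g"
        using C by (auto simp: class_C_def twice_partially_differentiable_def)
      show "continuous_on {0..} (shift ?y)"
      proof (rule continuous_on_coordinatewise_then_product)
        fix v
        show "continuous_on {0..} (\<lambda>\<epsilon>. shift ?y \<epsilon> v)"
          by (cases "v \<in> e") (auto simp: shift_def intro!: continuous_intros)
      qed
      show "shift ?y ` {0..} \<subseteq> e \<rightarrow>\<^sub>E {0..}"
        using mem[OF that] unfolding shift_def by (fastforce simp: PiE_iff)
    qed
    then have "((\<lambda>\<epsilon>. g (shift ?y \<epsilon>)) \<longlongrightarrow> g (shift ?y 0)) (at 0 within {0..})"
      by (simp add: continuous_on)
    then have "((\<lambda>\<epsilon>. g (shift ?y \<epsilon>)) \<longlongrightarrow> g ?y) (at 0 within {0..})"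
      by (simp only: y0)
    then show ?thesis
      by (rule tendsto_within_subset) auto
  qed
  have "\<forall>\<^sub>F \<epsilon> in at_right 0. g (shift (x(i := ?c)) \<epsilon>)
      \<le> (1 - u) * g (shift (x(i := a)) \<epsilon>) + u * g (shift (x(i := b)) \<epsilon>)"
    using eventually_at_right_less[of 0]
  proof eventually_elim
    case (elim \<epsilon>)
    have "shift x \<epsilon> \<in> e \<rightarrow>\<^sub>E {0<..}"
      using x elim unfolding shift_def by (fastforce simp: PiE_iff intro: add_nonneg_pos)
    from convex_onD[OF convex_on_coordinate_interior[OF C i this], of u "a + \<epsilon>" "b + \<epsilon>"]
    show ?case
      using u ab elim by (simp add: shift_upd algebra_simps)
  qed
  moreover have "?c \<ge> 0" using u ab by simp
  ultimately have "g (x(i := ?c)) \<le> (1 - u) * g (x(i := a)) + u * g (x(i := b))"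
    using ab by (intro tendsto_le[OF _ _ lim[of ?c]]) (auto intro!: tendsto_intros lim)
  then show "g (x(i := (1 - u) *\<^sub>R a + u *\<^sub>R b)) \<le> (1 - u) * g (x(i := a)) + u * g (x(i := b))"
    by simp
qed simp

section \<open>Joint monotonicity, and maxima of separable convex functions under a budget\<close>

text \<open>The coordinates are switched from \<open>x\<close> to \<open>y\<close> one at a time;
  all intermediate points stay in the orthant.\<close>

lemma nondecreasing_each_le:
  assumes mono: "nondecreasing_each e g" and fin: "finite e"
    and x: "x \<in> e \<rightarrow>\<^sub>E {0..}" and y: "y \<in> e \<rightarrow>\<^sub>E {0..}" and le: "\<And>u. u \<in> e \<Longrightarrow> x u \<le> y u"
  shows "g x \<le> g y"
proof -
  have "g x \<le> g (override_on x y A)" if "finite A" "A \<subseteq> e" for A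
    using that
  proof (induction A rule: finite_induct)
    case (insert a A)
    let ?z = "override_on x y A"
    have z: "?z \<in> e \<rightarrow>\<^sub>E {0..}"
      using x y by (auto simp: PiE_iff extensional_def override_on_def)
    have a: "a \<in> e" "?z a = x a" "x a \<le> y a" "0 \<le> x a"
      using insert x le by (auto simp: PiE_iff)
    have "mono_on {0..} (\<lambda>t. g (?z(a := t)))"
      using mono z a by (simp add: nondecreasing_each_def)
    then have "g (?z(a := x a)) \<le> g (?z(a := y a))"
      by (rule mono_onD) (use a in auto)
    moreover have "?z(a := x a) = ?z" using a by (simp add: fun_upd_idem)
    moreover have "override_on x y (insert a A) = ?z(a := y a)"
      by (rule override_on_insert)
    ultimately have "g ?z \<le> g (override_on x y (insert a A))" by metis
    then show ?case using insert by (meson insert_subset order_trans)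
  qed simp
  moreover have "override_on x y e = y"
    using x y by (auto simp: PiE_iff extensional_def override_on_def)
  ultimately show ?thesis using fin by (metis order_refl)
qed

text \<open>On the interval from 0 to \<open>b\<close> each \<open>\<phi> e\<close> lies below its
  chord, so the sum is bounded by a linear function of \<open>\<sigma>\<close>. That bound is
  largest when all of \<open>b\<close> goes to the steepest chord, and there the chords meet the
  functions.\<close>

lemma sum_convex_le_vertex:
  fixes \<phi> :: "'a \<Rightarrow> real \<Rightarrow> real"
  assumes fin: "finite I" and ne: "I \<noteq> {}"
    and conv: "\<And>e. e \<in> I \<Longrightarrow> convex_on {0..} (\<phi> e)"
    and mono: "\<And>e. e \<in> I \<Longrightarrow> mono_on {0..} (\<phi> e)"
    and nonneg: "\<And>e. e \<in> I \<Longrightarrow> \<sigma> e \<ge> 0" and le: "sum \<sigma> I \<le> b"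
  shows "\<exists>c\<in>I. (\<Sum>e\<in>I. \<phi> e (\<sigma> e)) \<le> (\<Sum>e\<in>I. \<phi> e (if e = c then b else 0))"
proof (cases "b = 0")
  case True
  then have "\<forall>e\<in>I. \<sigma> e = 0"
    using fin nonneg le by (metis order_antisym sum_nonneg sum_nonneg_eq_0_iff)
  then show ?thesis using ne True by auto
next
  case False
  have \<sigma>b: "\<sigma> e \<le> b" if "e \<in> I" for e
    using member_le_sum[of e I \<sigma>] fin nonneg le that by force
  have b: "b > 0" using False le sum_nonneg[of I \<sigma>] nonneg by force
  define d where "d e = \<phi> e b - \<phi> e 0" for e
  have "Max (d ` I) \<in> d ` I" using fin ne by simp
  then obtain c where c: "c \<in> I" and "Max (d ` I) = d c" by auto
  then have dmax: "d e \<le> d c" if "e \<in> I" for e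
    using fin that Max_ge[of "d ` I" "d e"] by simp
  \<comment> \<open>This handles unspent budget: as \<open>sum \<sigma> I\<close> may be below
    \<open>b\<close>, the steepest slope must not be negative.\<close>
  have dc: "d c \<ge> 0"
    using mono_onD[OF mono[OF c], of 0 b] b by (simp add: d_def)
  have chord: "\<phi> e (\<sigma> e) \<le> \<phi> e 0 + \<sigma> e / b * d c" if e: "e \<in> I" for e
  proof -
    have "\<phi> e (\<sigma> e) \<le> \<phi> e 0 + \<sigma> e / b * d e"
      using convex_onD[OF conv[OF e], of "\<sigma> e / b" 0 b] b nonneg[OF e] \<sigma>b[OF e]
      by (simp add: d_def algebra_simps)
    also have "\<dots> \<le> \<phi> e 0 + \<sigma> e / b * d c"
      using dmax[OF e] nonneg[OF e] b by (intro add_left_mono mult_left_mono) auto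
    finally show ?thesis .
  qed
  have "(\<Sum>e\<in>I. \<phi> e (\<sigma> e)) \<le> (\<Sum>e\<in>I. \<phi> e 0 + \<sigma> e / b * d c)"
    by (rule sum_mono) (rule chord)
  also have "\<dots> = (\<Sum>e\<in>I. \<phi> e 0) + sum \<sigma> I / b * d c"
    by (simp add: sum.distrib sum_distrib_right sum_divide_distrib)
  also have "\<dots> \<le> (\<Sum>e\<in>I. \<phi> e 0) + 1 * d c"
    using le b dc by (intro add_left_mono mult_right_mono) auto
  also have "\<dots> = (\<Sum>e\<in>I. \<phi> e 0 + (if e = c then d c else 0))"
    using fin c by (simp add: sum.distrib)
  also have "\<dots> = (\<Sum>e\<in>I. \<phi> e (if e = c then b else 0))"
    by (rule sum.cong) (auto simp: d_def)
  finally show ?thesis using c by blast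
qed

section \<open>Moving to a state in which every player is concentrated\<close>

context contribution_game
begin

lemma finite_hyperedges: "finite E"
  using finite_players hyperedges by (meson finite_Pow_iff finite_subset)

lemma finite_hyperedge: "e \<in> E \<Longrightarrow> finite e"
  using finite_players hyperedges by (meson PowD finite_subset subsetD)

lemma efforts_fun_upd:
  "efforts (s(v := \<sigma>)) e = (if v \<in> e then (efforts s e)(v := \<sigma> e) else efforts s e)"
  by (auto simp: efforts_def)

lemma welfare_eq_sum_hyperedges: "welfare s = (\<Sum>e\<in>E. card e * f e (efforts s e))"
proof -
  have "welfare s = (\<Sum>v\<in>V. \<Sum>e | e \<in> E \<and> v \<in> e. f e (efforts s e))"
    by (simp add: welfare_def utility_def)
  also have "\<dots> = (\<Sum>e\<in>E. \<Sum>v | v \<in> V \<and> v \<in> e. f e (efforts s e))"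
    by (rule sum.swap_restrict[OF finite_players finite_hyperedges])
  also have "\<dots> = (\<Sum>e\<in>E. card e * f e (efforts s e))"
  proof (rule sum.cong)
    fix e assume "e \<in> E"
    then have "{v \<in> V. v \<in> e} = e" using hyperedges by auto
    then show "(\<Sum>v | v \<in> V \<and> v \<in> e. f e (efforts s e)) = card e * f e (efforts s e)" by simp
  qed simp
  finally show ?thesis .
qed

text \<open>A player without projects is concentrated on every \<open>c\<close>, so each player can
  be assigned some \<open>c\<close>.\<close>

definition concentrated :: "('v \<Rightarrow> 'v set \<Rightarrow> real) \<Rightarrow> 'v \<Rightarrow> 'v set \<Rightarrow> bool"
  where "concentrated s v c \<longleftrightarrow> (\<forall>e\<in>E. v \<in> e \<longrightarrow> s v e = (if e = c then B v else 0))"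

text \<open>With the other strategies fixed, the welfare from the projects of \<open>v\<close> is a
  sum of convex nondecreasing functions of the single efforts \<open>s v e\<close>, weighted by
  \<open>card e\<close> because every member collects the reward. The vertex bound supplies
  \<open>c\<close>; the remaining projects do not see the change.\<close>

lemma concentrate_player:
  assumes C: "\<forall>e\<in>E. class_C e (f e)" and s: "s \<in> states" and v: "v \<in> V"
  shows "\<exists>\<sigma> c. s(v := \<sigma>) \<in> states \<and> concentrated (s(v := \<sigma>)) v c
    \<and> welfare s \<le> welfare (s(v := \<sigma>))"
proof (cases "{e \<in> E. v \<in> e} = {}")
  case True
  then have "concentrated s v c" for c by (auto simp: concentrated_def)
  then show ?thesis using s by (metis fun_upd_triv order_refl)
next
  case False
  let ?I = "{e \<in> E. v \<in> e}"
  let ?\<phi> = "\<lambda>e t. card e * f e ((efforts s e)(v := t))"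
  have fin: "finite ?I" using finite_hyperedges by simp
  have conv: "convex_on {0..} (?\<phi> e)" if "e \<in> ?I" for e
    using convex_on_coordinate[OF _ _ efforts_orthant[OF s]] C that
    by (intro convex_on_cmul) auto
  have mono: "mono_on {0..} (?\<phi> e)" if "e \<in> ?I" for e
  proof -
    have "mono_on {0..} (\<lambda>t. f e ((efforts s e)(v := t)))"
      using C that efforts_orthant[OF s] by (auto simp: class_C_def nondecreasing_each_def)
    then show ?thesis by (auto simp: mono_on_def intro!: mult_left_mono)
  qed
  have sv: "s v \<in> strategies v" using s v by (auto simp: states_def)
  have nonneg: "s v e \<ge> 0" if "e \<in> ?I" for e
    using sv that by (auto simp: strategies_def PiE_iff)
  have le: "sum (s v) ?I \<le> B v" using sv by (auto simp: strategies_def)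
  obtain c where c: "c \<in> ?I"
    and better: "(\<Sum>e\<in>?I. ?\<phi> e (s v e)) \<le> (\<Sum>e\<in>?I. ?\<phi> e (if e = c then B v else 0))"
    using sum_convex_le_vertex[of ?I ?\<phi> "s v" "B v", OF fin False conv mono nonneg le] by blast
  define \<sigma> where "\<sigma> = (\<lambda>e\<in>?I. if e = c then B v else 0)"
  have "sum \<sigma> ?I = (\<Sum>e\<in>?I. if e = c then B v else 0)"
    by (rule sum.cong) (auto simp: \<sigma>_def)
  also have "\<dots> = B v" using fin c by simp
  finally have "\<sigma> \<in> strategies v"
    using budget_nonneg[OF v] by (auto simp: strategies_def \<sigma>_def)
  then have st: "s(v := \<sigma>) \<in> states"
    using s v by (auto simp: states_def PiE_iff extensional_def)
  have split: "welfare s' = (\<Sum>e\<in>?I. card e * f e (efforts s' e))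
      + (\<Sum>e\<in>E - ?I. card e * f e (efforts s' e))" for s'
    unfolding welfare_eq_sum_hyperedges
    by (subst sum.subset_diff[of ?I]) (use finite_hyperedges in auto)
  have "(\<Sum>e\<in>?I. card e * f e (efforts s e)) = (\<Sum>e\<in>?I. ?\<phi> e (s v e))"
    by (rule sum.cong) (auto simp: efforts_def fun_upd_idem)
  also note better
  also have "(\<Sum>e\<in>?I. ?\<phi> e (if e = c then B v else 0))
      = (\<Sum>e\<in>?I. card e * f e (efforts (s(v := \<sigma>)) e))"
    by (rule sum.cong) (auto simp: efforts_fun_upd \<sigma>_def)
  finally have 1: "(\<Sum>e\<in>?I. card e * f e (efforts s e))
      \<le> (\<Sum>e\<in>?I. card e * f e (efforts (s(v := \<sigma>)) e))" .
  have 2: "(\<Sum>e\<in>E - ?I. card e * f e (efforts (s(v := \<sigma>)) e))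
      = (\<Sum>e\<in>E - ?I. card e * f e (efforts s e))"
    by (rule sum.cong) (auto simp: efforts_fun_upd)
  have "welfare s \<le> welfare (s(v := \<sigma>))"
    unfolding split[of s] split[of "s(v := \<sigma>)"] using 1 2 by linarith
  moreover have "concentrated (s(v := \<sigma>)) v c"
    by (auto simp: concentrated_def \<sigma>_def)
  ultimately show ?thesis using st by blast
qed

lemma concentrate_all:
  assumes C: "\<forall>e\<in>E. class_C e (f e)" and s: "s \<in> states"
  shows "\<exists>t\<in>states. welfare s \<le> welfare t \<and> (\<forall>v\<in>V. \<exists>c. concentrated t v c)"
proof -
  have "\<exists>t\<in>states. welfare s \<le> welfare t \<and> (\<forall>v\<in>W. \<exists>c. concentrated t v c)"
    if "finite W" "W \<subseteq> V" for W
    using that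
  proof (induction W rule: finite_induct)
    case empty
    then show ?case using s by auto
  next
    case (insert v W)
    then obtain t where t: "t \<in> states" "welfare s \<le> welfare t" "\<forall>w\<in>W. \<exists>c. concentrated t w c"
      by auto
    have "v \<in> V" using insert by simp
    then obtain \<sigma> c where \<sigma>: "t(v := \<sigma>) \<in> states" "concentrated (t(v := \<sigma>)) v c"
      "welfare t \<le> welfare (t(v := \<sigma>))"
      using concentrate_player[OF C t(1)] by blast
    have "\<exists>c. concentrated (t(v := \<sigma>)) w c" if "w \<in> insert v W" for w
    proof (cases "w = v")
      \<comment> \<open>The move of \<open>v\<close> leaves the strategy of \<open>w\<close>
        untouched, so its concentration survives.\<close>
      case False
      then show ?thesis using t(3) that by (auto simp: concentrated_def)
    qed (use \<sigma> in auto)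
    then show ?case using \<sigma> t(2) by (meson order_trans)
  qed
  then show ?thesis using finite_players by blast
qed

section \<open>Charging the rewards to utilities in the equilibrium\<close>

abbreviation base_reward :: "'v set \<Rightarrow> real"
  where "base_reward e \<equiv> f e (\<lambda>u\<in>e. 0)"

lemma base_reward_le:
  assumes "\<forall>e\<in>E. class_C e (f e)" "s \<in> states" "e \<in> E"
  shows "base_reward e \<le> f e (efforts s e)"
proof (rule nondecreasing_each_le[where g = "f e" and e = e])
  show "nondecreasing_each e (f e)" using assms by (simp add: class_C_def)
  show "efforts s e \<in> e \<rightarrow>\<^sub>E {0..}" using assms efforts_orthant by blast
  then show "\<And>u. u \<in> e \<Longrightarrow> (\<lambda>u\<in>e. 0) u \<le> efforts s e u" by (auto simp: PiE_iff)
qed (use finite_hyperedge assms in auto)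

lemma override_on_states:
  assumes "s \<in> states" "t \<in> states"
  shows "override_on s t U \<in> states"
  using assms by (auto simp: states_def PiE_iff extensional_def override_on_def)

text \<open>Let \<open>U\<close> deviate to its strategies in \<open>t\<close>. Members of
  \<open>e\<close> outside \<open>U\<close> contribute 0 to \<open>e\<close> in \<open>t\<close>, so
  \<open>e\<close> then pays at least what it pays in \<open>t\<close>, and every other project of a
  deviator pays at least its base reward. Some deviator does not profit, which bounds its utility in
  \<open>s\<close> from below.\<close>

lemma equilibrium_pays_reward:
  assumes C: "\<forall>e\<in>E. class_C e (f e)" and eq: "setwise_equilibrium s" and t: "t \<in> states"
    and e: "e \<in> E" and U: "U \<subseteq> e" "U \<noteq> {}" and zero: "\<And>u. u \<in> e - U \<Longrightarrow> t u e = 0"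
  shows "\<exists>v\<in>U. f e (efforts t e) - base_reward e
    \<le> utility v s - (\<Sum>e' | e' \<in> E \<and> v \<in> e'. base_reward e')"
proof -
  let ?s = "override_on s t U"
  have UV: "U \<subseteq> V" using U e hyperedges by auto
  have s: "s \<in> states" using eq by (simp add: setwise_equilibrium_def)
  have s': "?s \<in> states" by (rule override_on_states[OF s t])
  have "restrict t U \<in> (\<Pi>\<^sub>E u\<in>U. strategies u)"
    using t UV by (auto simp: states_def PiE_iff)
  moreover have "override_on s (restrict t U) U = ?s"
    by (auto simp: override_on_def)
  ultimately obtain v where v: "v \<in> U" "utility v ?s \<le> utility v s"
    using eq e U unfolding setwise_equilibrium_def by metis
  let ?I = "{e' \<in> E. v \<in> e'}"
  have fin: "finite ?I" using finite_hyperedges by simp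
  have eI: "e \<in> ?I" using e v U by auto
  have "f e (efforts t e) \<le> f e (efforts ?s e)"
  proof (rule nondecreasing_each_le[where g = "f e" and e = e])
    show "nondecreasing_each e (f e)" using C e by (simp add: class_C_def)
    show "efforts t e \<in> e \<rightarrow>\<^sub>E {0..}" using e t efforts_orthant by blast
    show "efforts ?s e \<in> e \<rightarrow>\<^sub>E {0..}" using e s' efforts_orthant by blast
    then show "efforts t e u \<le> efforts ?s e u" if "u \<in> e" for u
      using that zero[of u] by (cases "u \<in> U") (auto simp: efforts_def PiE_iff)
  qed (use finite_hyperedge e in auto)
  moreover have "(\<Sum>e'\<in>?I - {e}. base_reward e') \<le> (\<Sum>e'\<in>?I - {e}. f e' (efforts ?s e'))"
    using base_reward_le[OF C s'] by (intro sum_mono) auto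
  moreover have "utility v ?s = f e (efforts ?s e) + (\<Sum>e'\<in>?I - {e}. f e' (efforts ?s e'))"
    unfolding utility_def by (rule sum.remove[OF fin eI])
  moreover have "(\<Sum>e'\<in>?I. base_reward e')
      = base_reward e + (\<Sum>e'\<in>?I - {e}. base_reward e')"
    by (rule sum.remove[OF fin eI])
  ultimately show ?thesis using v by (intro bexI[of _ v]) linarith+
qed

lemma concentrated_welfare_le:
  assumes C: "\<forall>e\<in>E. class_C e (f e)" and eq: "setwise_equilibrium s" and t: "t \<in> states"
    and conc: "\<forall>v\<in>V. \<exists>c. concentrated t v c"
  shows "welfare t \<le> Max (card ` E) * welfare s"
\<comment> \<open>In this case both welfares vanish. This covers \<open>E = {}\<close>, where
  \<open>Max\<close> has no meaningful value; otherwise the maximum is at least 1.\<close>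
proof (cases "\<forall>e\<in>E. card e = 0")
  case True
  then show ?thesis by (simp add: welfare_eq_sum_hyperedges)
next
  case False
  let ?k = "Max (card ` E)"
  have k: "card e \<le> ?k" if "e \<in> E" for e using finite_hyperedges that by simp
  have "?k \<ge> 1" using False k by (metis One_nat_def Suc_leI le_zero_eq neq0_conv)
  have s: "s \<in> states" using eq by (simp add: setwise_equilibrium_def)
  obtain c where c: "\<And>v. v \<in> V \<Longrightarrow> concentrated t v (c v)" using conc by metis
  define U where "U e = {v \<in> e. c v = e}" for e
  define gain where "gain e = f e (efforts t e) - base_reward e" for e
  define surplus where "surplus v = utility v s - (\<Sum>e | e \<in> E \<and> v \<in> e. base_reward e)" for v
  define base where "base = (\<Sum>e\<in>E. card e * base_reward e)"
  have zero: "t u e = 0" if "e \<in> E" "u \<in> e - U e" for u e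
    using c[of u] that hyperedges unfolding concentrated_def U_def
    by (metis (mono_tags, lifting) DiffE PowD mem_Collect_eq subsetD)
  have gain_nonneg: "gain e \<ge> 0" if "e \<in> E" for e
    using base_reward_le[OF C t that] by (simp add: gain_def)
  have surplus_nonneg: "surplus v \<ge> 0" for v
    unfolding surplus_def utility_def
    using base_reward_le[OF C s] by (auto intro!: sum_mono)
  \<comment> \<open>Only projects with a nonempty \<open>U e\<close> admit a deviation; the others
    are idle in \<open>t\<close> and have gain 0.\<close>
  define E' where "E' = {e \<in> E. U e \<noteq> {}}"
  have "\<exists>v\<in>U e. gain e \<le> surplus v" if "e \<in> E'" for e
    using equilibrium_pays_reward[OF C eq t, of e "U e"] that zero
    by (auto simp: E'_def U_def gain_def surplus_def)
  then obtain r where r: "\<And>e. e \<in> E' \<Longrightarrow> r e \<in> U e" "\<And>e. e \<in> E' \<Longrightarrow> gain e \<le> surplus (r e)"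
    by metis
  \<comment> \<open>A player is concentrated on one project only: \<open>r e \<in> U e\<close> gives
    \<open>c (r e) = e\<close>, so no surplus is charged twice.\<close>
  have inj: "inj_on r E'"
    by (rule inj_on_inverseI[where g = c]) (use r(1) in \<open>auto simp: U_def\<close>)
  have rV: "r ` E' \<subseteq> V" using r(1) hyperedges by (fastforce simp: U_def E'_def)
  have idle: "gain e = 0" if "e \<in> E - E'" for e
  proof -
    have "efforts t e = (\<lambda>u\<in>e. 0)"
      using zero[of e] that by (auto simp: efforts_def E'_def)
    then show ?thesis by (simp add: gain_def)
  qed
  have "sum gain E = sum gain E'"
    by (rule sum.mono_neutral_right) (use finite_hyperedges idle in \<open>auto simp: E'_def\<close>)
  also have "\<dots> \<le> (\<Sum>e\<in>E'. surplus (r e))" by (rule sum_mono) (rule r)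
  also have "\<dots> = sum surplus (r ` E')" by (simp add: sum.reindex[OF inj])
  also have "\<dots> \<le> sum surplus V"
    by (rule sum_mono2[OF finite_players rV]) (rule surplus_nonneg)
  also have "\<dots> = welfare s - (\<Sum>v\<in>V. \<Sum>e | e \<in> E \<and> v \<in> e. base_reward e)"
    by (simp add: surplus_def sum_subtractf welfare_def)
  \<comment> \<open>Double counting, read off from the welfare identity at the all-zero profile;
    that identity holds for arbitrary functions, not just for states.\<close>
  also have "(\<Sum>v\<in>V. \<Sum>e | e \<in> E \<and> v \<in> e. base_reward e) = base"
    using welfare_eq_sum_hyperedges[of "\<lambda>_ _. 0"]
    by (simp add: welfare_def utility_def efforts_def base_def)
  finally have gain_le: "sum gain E \<le> welfare s - base" .
  have base_nonneg: "base \<ge> 0"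
    unfolding base_def by (intro sum_nonneg mult_nonneg_nonneg reward_nonneg) auto
  have "welfare t = base + (\<Sum>e\<in>E. card e * gain e)"
    by (simp add: welfare_eq_sum_hyperedges base_def gain_def algebra_simps sum.distrib[symmetric])
  \<comment> \<open>The factor \<open>?k\<close> arises here: one charged player pays for the gains
    of all \<open>card e\<close> members.\<close>
  also have "(\<Sum>e\<in>E. card e * gain e) \<le> (\<Sum>e\<in>E. ?k * gain e)"
    using k gain_nonneg by (intro sum_mono mult_right_mono) auto
  also have "\<dots> = ?k * sum gain E" by (simp add: sum_distrib_left)
  also have "\<dots> \<le> ?k * (welfare s - base)" using gain_le by (intro mult_left_mono) auto
  \<comment> \<open>Since \<open>?k \<ge> 1\<close> and \<open>base \<ge> 0\<close>, the single
    \<open>base\<close> is absorbed by \<open>?k * base\<close>.\<close>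
  also have "base + ?k * (welfare s - base) \<le> ?k * welfare s"
    using mult_right_mono[of 1 "real ?k" base] \<open>?k \<ge> 1\<close> base_nonneg
    by (simp add: algebra_simps)
  finally show ?thesis by simp
qed

section \<open>From the welfare bound to the price of anarchy\<close>

lemma welfare_le_equilibrium:
  assumes C: "\<forall>e\<in>E. class_C e (f e)" and eq: "setwise_equilibrium s" and s': "s' \<in> states"
  shows "welfare s' \<le> Max (card ` E) * welfare s"
  using concentrate_all[OF C s'] concentrated_welfare_le[OF C eq] by force

end

theorem corollary8p2:
  fixes V :: "'v set"
    and E :: "'v set set"
    and B :: "'v \<Rightarrow> real"
    and f :: "'v set \<Rightarrow> ('v \<Rightarrow> real) \<Rightarrow> real"
  assumes "contribution_game V E B f"
    and "\<forall>e\<in>E. class_C e (f e)"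
    and "\<exists>s. contribution_game.setwise_equilibrium V E B f s"
  shows "contribution_game.price_of_anarchy V E B f \<le> of_nat (Max (card ` E))"
proof -
  interpret contribution_game V E B f by fact
  have "ennreal (welfare t) / ennreal (welfare s) \<le> of_nat (Max (card ` E))"
    if "setwise_equilibrium s" "social_optimum t" for s t
  proof -
    have le: "welfare t \<le> Max (card ` E) * welfare s"
      using welfare_le_equilibrium assms(2) that by (auto simp: social_optimum_def)
    show ?thesis
    proof (cases "welfare s > 0")
      case True
      have "ennreal (welfare t) \<le> of_nat (Max (card ` E)) * ennreal (welfare s)"
        using le True
        by (simp add: ennreal_of_nat_eq_real_of_nat ennreal_mult[symmetric] ennreal_leI)
      then show ?thesis using True by (intro divide_le_posI_ennreal) (auto simp: mult.commute)
    next
      \<comment> \<open>The welfare bound forces the optimum to have welfare at most 0 too, so the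
        numerator is 0 in \<open>ennreal\<close> and the quotient is 0 rather than infinite.\<close>
      case False
      then have "welfare t \<le> 0"
        using le mult_nonneg_nonpos[of "real (Max (card ` E))" "welfare s"] by simp
      then show ?thesis by (simp add: ennreal_neg)
    qed
  qed
  then show ?thesis
    unfolding price_of_anarchy_def by (intro SUP_least) auto
qed

end
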